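(* Let $N_r,N_y,N_v\ge 1$ be integers and let $G\in\mathbb{C}^{N_r\times N_y}$ have columns $g_1,\dots,g_{N_y}$ with $\|g_j\|_2=1$ for all $j$ and $|\mu(g_j,g_q)|<1$ for all $j\neq q$. Let $X\in\mathbb{C}^{N_y\times N_v}$ be a nonzero matrix with row support $\mathcal{S}$, let $W\in\mathbb{C}^{N_r\times N_v}$, set $D_W=GX+W$, and let $\varepsilon>0$ satisfy $\|W\|_F<\varepsilon$. Let $X^\varepsilon$ be a minimizer of $$\text{minimize } \|Z\|_{1,2}\ \text{ over } Z\in\mathbb{C}^{N_y\times N_v}\ \text{ subject to } \|GZ-D_W\|_F\le\varepsilon,$$ and let $W^\varepsilon=G(X^\varepsilon-X)$. Then $$\|W^\varepsilon\|_F\le 2\varepsilon .$$ Suppose moreover that $r\in(0,1)$ satisfies $2\mathcal{I}_{N_v}<r<1$, where $\mathcal{I}_{N_v}$ is the multiple view interaction coefficient of $X$, and let $$\mathcal{B}_r(\mathcal{S})=\{1\le j\le N_y:\ \exists\, q\in\mathcal{S}\text{ with } \mathfrak{D}(j,q)<r\}.$$ Decompose $X^\varepsilon=X^{\varepsilon,r}+E^{\varepsilon,r}$, where $X^{\varepsilon,r}$ is row supported in $\mathcal{B}_r(\mathcal{S})$ and $E^{\varepsilon,r}$ is row supported in $\{1,\dots,N_y\}\setminus\mathcal{B}_r(\mathcal{S})$. Then $$\|E^{\varepsilon,r}\|_{1,2}\le\frac{2\mathcal{I}_{N_v}}{r}\|X^\varepsilon\|_{1,2}+\frac1r\big\|(G^\star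 W^\varepsilon)_{\mathcal{S}\rightarrow}\big\|_{1,2}\le\frac{2\mathcal{I}_{N_v}}{r}\|X^\varepsilon\|_{1,2}+\frac{2\varepsilon|\mathcal{S}|}{r}.$$
   Context: Rows of a matrix $Z$ are denoted $z_{j\rightarrow}$. The row support of $X$ is the set $\mathcal{S}\subset\{1,\dots,N_y\}$ of indices of its nonzero rows; a matrix is row supported in a set if its rows with index outside that set vanish. $\|Z\|_{1,2}=\sum_j\|z_{j\rightarrow}\|_2$ and $\|\cdot\|_F$ is the Frobenius norm. $\star$ denotes conjugate transpose, and $M_{\mathcal{S}\rightarrow}$ is the restriction of a matrix $M$ to the rows indexed by $\mathcal{S}$. For columns of $G$, $\mu(g_j,g_q)=g_j^\star g_q$. For nonzero row vectors $v,x\in\mathbb{C}^{1\times N_v}$, $\mu(v,x)=\dfrac{v x^\star}{\|v\|_2\|x\|_2}$. The semimetric is $\mathfrak{D}(j,q)=1-|\mu(g_j,g_q)|$ for $j,q\in\{1,\dots,N_y\}$. For each $j\in\{1,\dots,N_y\}$, $n(j)\in\mathcal{S}$ is an index minimizing $\mathfrak{D}(j,q)$ over $q\in\mathcal{S}$ (if the minimizer is not unique, one is picked and fixed). The multiple view interaction coefficient of $X$ is $$\mathcal{I}_{N_v}=\max_{1\le j\le N_y}\ \sup_{0\ne v\in\mathbb{C}^{1\times N_v}}\ \sum_{q\in\mathcal{S}\setminus\{n(j)\}}|\mu(g_j,g_q)|\,|\mu(v,x_{q\rightarrow})|.$$ *)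

theory Defs
  imports "HOL-Analysis.Analysis"
begin

text \<open>
  A complex \<open>N\<^sub>r \<times> N\<^sub>y\<close> matrix is an element of \<^typ>\<open>complex ^ 'y ^ 'r\<close>, where the finite
  index types have cardinalities \<open>N\<^sub>r\<close> and \<open>N\<^sub>y\<close>.  On \<^typ>\<open>complex ^ 'n\<close> the library's
  \<^const>\<open>norm\<close> is the Euclidean norm, and on \<^typ>\<open>complex ^ 'n ^ 'm\<close> it is the Euclidean norm of
  the vector of row norms, that is, the Frobenius norm.
\<close>

definition conj_transpose :: "complex ^ 'n ^ 'm \<Rightarrow> complex ^ 'm ^ 'n" where
  "conj_transpose A = (\<chi> i j. cnj (A $ j $ i))"

definition norm12 :: "complex ^ 'n ^ 'm \<Rightarrow> real" where
  "norm12 Z = (\<Sum>j\<in>UNIV. norm (row j Z))"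

definition row_support :: "complex ^ 'n ^ 'm \<Rightarrow> 'm set" where
  "row_support Z = {j. row j Z \<noteq> 0}"

definition row_supported_in :: "'m set \<Rightarrow> complex ^ 'n ^ 'm \<Rightarrow> bool" where
  "row_supported_in A Z \<longleftrightarrow> (\<forall>j. j \<notin> A \<longrightarrow> row j Z = 0)"

text \<open>
  The row index set of a restricted matrix is not a type, so the restriction keeps the ambient
  format and fills the other rows with zeros, which do not contribute to \<^const>\<open>norm12\<close>.
\<close>

definition restrict_rows :: "'m set \<Rightarrow> complex ^ 'n ^ 'm \<Rightarrow> complex ^ 'n ^ 'm" where
  "restrict_rows A M = (\<chi> j. if j \<in> A then row j M else 0)"

text \<open>
  The correlation \<open>\<mu>\<close> is conjugate linear in the first argument for columns, and in the
  second argument, after normalization, for rows.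
\<close>

definition mu_col :: "complex ^ 'n \<Rightarrow> complex ^ 'n \<Rightarrow> complex" where
  "mu_col g h = (\<Sum>i\<in>UNIV. cnj (g $ i) * h $ i)"

definition mu_row :: "complex ^ 'n \<Rightarrow> complex ^ 'n \<Rightarrow> complex" where
  "mu_row v x = (\<Sum>k\<in>UNIV. v $ k * cnj (x $ k)) / complex_of_real (norm v * norm x)"

definition semimetric :: "complex ^ 'y ^ 'r \<Rightarrow> 'y \<Rightarrow> 'y \<Rightarrow> real" where
  "semimetric G j q = 1 - cmod (mu_col (column j G) (column q G))"

definition semimetric_nbhd :: "complex ^ 'y ^ 'r \<Rightarrow> real \<Rightarrow> 'y set \<Rightarrow> 'y set" where
  "semimetric_nbhd G r S = {j. \<exists>q\<in>S. semimetric G j q < r}"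

text \<open>A fixed choice of a closest point of \<open>S\<close> for every index; ties are broken arbitrarily.\<close>

definition nearest_selection :: "complex ^ 'y ^ 'r \<Rightarrow> 'y set \<Rightarrow> ('y \<Rightarrow> 'y) \<Rightarrow> bool" where
  "nearest_selection G S n \<longleftrightarrow> (\<forall>j. is_arg_min (semimetric G j) (\<lambda>q. q \<in> S) (n j))"

text \<open>
  The supremum is over a nonempty set of reals, bounded above because \<open>\<bar>\<mu>(v, x)\<bar> \<le> 1\<close> by the
  Cauchy-Schwarz inequality.  The value may depend on the selection \<open>n\<close>.
\<close>

definition interaction_coeff ::
  "complex ^ 'y ^ 'r \<Rightarrow> complex ^ 'v ^ 'y \<Rightarrow> ('y \<Rightarrow> 'y) \<Rightarrow> real" where
  "interaction_coeff G X n =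
     (MAX j\<in>UNIV. SUP v\<in>{v. v \<noteq> 0}.
        \<Sum>q\<in>row_support X - {n j}.
          cmod (mu_col (column j G) (column q G)) * cmod (mu_row v (row q X)))"

end

theory Submission
  imports Defs
begin

text \<open>
  The rows \<open>x\<^sub>q / \<parallel>x\<^sub>q\<parallel>\<close> with \<open>q\<close> in \<open>S\<close> serve as an approximate dual certificate: pairing them with the
  rows of \<open>G\<^sup>\<star>GZ\<close> gives a linear functional of \<open>Z\<close> in which the row \<open>z\<^sub>j\<close> contributes at most
  \<open>(\<bar>\<mu>(g\<^sub>j, g\<^bsub>n(j)\<^esub>)\<bar> + \<I>) \<parallel>z\<^sub>j\<parallel>\<close>.  The first factor is at most \<open>1 + \<I>\<close>, and at most \<open>1 - r + \<I>\<close> when \<open>j\<close>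
  lies outside the neighbourhood of \<open>S\<close>, so the value at \<open>X\<^sup>\<epsilon>\<close> is at most
  \<open>(1 + \<I>) \<parallel>X\<^sup>\<epsilon>\<parallel> - r \<parallel>E\<parallel>\<close>, while the value at \<open>X\<close> is at least \<open>(1 - \<I>) \<parallel>X\<parallel> \<ge> (1 - \<I>) \<parallel>X\<^sup>\<epsilon>\<parallel>\<close>.
  The two values differ by at most \<open>\<parallel>(G\<^sup>\<star>W\<^sup>\<epsilon>)\<^sub>S\<parallel>\<close>.
\<close>

lemma norm_mu_col_le: "cmod (mu_col x v) \<le> norm x * norm v"
proof -
  have "cmod (mu_col x v) \<le> (\<Sum>i\<in>UNIV. \<bar>norm (x $ i)\<bar> * \<bar>norm (v $ i)\<bar>)"
    unfolding mu_col_def by (rule order_trans[OF norm_sum]) (simp add: norm_mult)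
  also have "\<dots> \<le> norm x * norm v"
    unfolding norm_vec_def by (rule L2_set_mult_ineq)
  finally show ?thesis .
qed

lemma norm_mu_col_commute: "cmod (mu_col x v) = cmod (mu_col v x)"
proof -
  have "mu_col x v = cnj (mu_col v x)"
    by (simp add: mu_col_def mult.commute)
  then show ?thesis by simp
qed

lemma mu_col_self: "mu_col x x = complex_of_real ((norm x)\<^sup>2)"
proof -
  have "(norm x)\<^sup>2 = (\<Sum>i\<in>UNIV. (cmod (x $ i))\<^sup>2)"
    by (simp add: norm_vec_def L2_set_def sum_nonneg)
  then show ?thesis
    by (simp add: mu_col_def complex_norm_square mult.commute del: of_real_power)
qed

lemma mu_col_sum_scale: "mu_col x (\<Sum>j\<in>A. c j *s z j) = (\<Sum>j\<in>A. c j * mu_col x (z j))"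
proof -
  have "mu_col x (\<Sum>j\<in>A. c j *s z j) = (\<Sum>i\<in>UNIV. \<Sum>j\<in>A. c j * (cnj (x $ i) * z j $ i))"
    by (simp add: mu_col_def sum_distrib_left mult_ac)
  also have "\<dots> = (\<Sum>j\<in>A. c j * mu_col x (z j))"
    by (subst sum.swap) (simp add: mu_col_def sum_distrib_left)
  finally show ?thesis .
qed

lemma norm_mu_row: "cmod (mu_row v x) = cmod (mu_col x v) / (norm v * norm x)"
  by (simp add: mu_row_def mu_col_def norm_divide norm_mult mult.commute)

lemma norm_mu_row_le_1: "cmod (mu_row v x) \<le> 1"
proof (cases "norm v * norm x = 0")
  case False
  then have "norm v * norm x > 0" by (simp add: less_le)
  then show ?thesis
    using norm_mu_col_le[of x v] by (simp add: norm_mu_row mult.commute)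
qed (simp only: norm_mu_row, simp)

text \<open>Trades normalization by \<open>x\<close>, as in the certificate, for normalization by
  both vectors, as in the interaction coefficient. Zero vectors are harmless because division by
  zero yields 0.\<close>

lemma norm_mu_col_div:
  "cmod (mu_col x v) / norm x = norm v * cmod (mu_row v x)"
  using norm_mu_col_le[of x v] by (cases "v = 0") (auto simp: norm_mu_row)

lemma matrix_mult_diff_right: "A ** (B - C) = A ** B - A ** C" for A :: "'a :: ring_1 ^ 'n ^ 'm"
  by (simp add: vec_eq_iff matrix_matrix_mult_def right_diff_distrib sum_subtractf)

lemma row_conj_transpose_mult:
  "row q (conj_transpose G ** Z) = (\<Sum>i\<in>UNIV. cnj (G $ i $ q) *s row i Z)"
  by (simp add: vec_eq_iff row_def matrix_matrix_mult_def conj_transpose_def)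

lemma row_gram_mult:
  "row q (conj_transpose G ** (G ** Z)) =
     (\<Sum>j\<in>UNIV. mu_col (column q G) (column j G) *s row j Z)"
proof -
  have "conj_transpose G ** (G ** Z) = (conj_transpose G ** G) ** Z"
    by (simp add: matrix_mul_assoc)
  then show ?thesis
    by (simp add: vec_eq_iff row_def matrix_matrix_mult_def conj_transpose_def mu_col_def column_def)
qed

text \<open>The row is a combination of the rows of \<open>Z\<close> with the conjugated entries of
  \<open>column q G\<close> as weights. Cauchy-Schwarz over these rows applies because the Frobenius
  norm is the Euclidean norm of the row norms.\<close>

lemma norm_row_conj_transpose_mult_le:
  "norm (row q (conj_transpose G ** Z)) \<le> norm (column q G) * norm Z"
proof -
  have scale: "norm (c *s (z :: complex ^ 'n)) = cmod c * norm z" for c z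
    by (simp add: norm_vec_def norm_mult L2_set_right_distrib)
  have "norm (row q (conj_transpose G ** Z)) \<le>
      (\<Sum>i\<in>UNIV. \<bar>norm (column q G $ i)\<bar> * \<bar>norm (Z $ i)\<bar>)"
    unfolding row_conj_transpose_mult
    by (rule order_trans[OF norm_sum]) (simp add: scale column_def row_def vec_lambda_eta)
  also have "\<dots> \<le> norm (column q G) * norm Z"
    unfolding norm_vec_def[of "column q G"] norm_vec_def[of Z] by (rule L2_set_mult_ineq)
  finally show ?thesis .
qed

lemma norm12_restrict_rows: "norm12 (restrict_rows S M) = (\<Sum>q\<in>S. norm (row q M))"
proof -
  have "norm12 (restrict_rows S M) = (\<Sum>q\<in>UNIV. if q \<in> S then norm (row q M) else 0)"
    unfolding norm12_def by (intro sum.cong) (auto simp: restrict_rows_def row_def vec_lambda_eta)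
  then show ?thesis by (simp add: sum.If_cases)
qed

lemma interaction_coeff_ge:
  assumes "v \<noteq> 0"
  shows "(\<Sum>q\<in>row_support X - {n j}.
           cmod (mu_col (column j G) (column q G)) * cmod (mu_row v (row q X)))
         \<le> interaction_coeff G X n"
proof -
  let ?f = "\<lambda>j v. \<Sum>q\<in>row_support X - {n j}.
           cmod (mu_col (column j G) (column q G)) * cmod (mu_row v (row q X))"
  have "?f j v \<le> (SUP v\<in>{v. v \<noteq> 0}. ?f j v)"
  proof (rule cSUP_upper)
    \<comment> \<open>A real \<open>SUP\<close> bounds its members only if the set is bounded above.
      Replacing each row correlation by 1 gives a bound that does not depend on
      \<open>v\<close>.\<close>
    show "bdd_above (?f j ` {v. v \<noteq> 0})"
    proof (rule bdd_aboveI2)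
      fix v
      show "?f j v \<le> (\<Sum>q\<in>row_support X - {n j}. cmod (mu_col (column j G) (column q G)))"
        by (intro sum_mono mult_left_le norm_mu_row_le_1 norm_ge_zero)
    qed
  qed (use assms in simp)
  also have "\<dots> \<le> interaction_coeff G X n"
    unfolding interaction_coeff_def by (intro Max_ge) auto
  finally show ?thesis .
qed

text \<open>The homogeneous form in which the coefficient is applied to a row \<open>v\<close> of a
  matrix. The supremum omits \<open>v = 0\<close>, where both sides vanish.\<close>

lemma interaction_sum_le:
  "(\<Sum>q\<in>row_support X - {n j}.
      cmod (mu_col (column j G) (column q G)) * (cmod (mu_col (row q X) v) / norm (row q X)))
    \<le> interaction_coeff G X n * norm v"
proof (cases "v = 0")
  case True
  then show ?thesis by (simp add: mu_col_def)
next
  case False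
  have "(\<Sum>q\<in>row_support X - {n j}.
      cmod (mu_col (column j G) (column q G)) * (cmod (mu_col (row q X) v) / norm (row q X)))
    = norm v * (\<Sum>q\<in>row_support X - {n j}.
           cmod (mu_col (column j G) (column q G)) * cmod (mu_row v (row q X)))"
    by (simp add: norm_mu_col_div sum_distrib_left mult_ac)
  also have "\<dots> \<le> norm v * interaction_coeff G X n"
    by (intro mult_left_mono interaction_coeff_ge False) simp
  finally show ?thesis by (simp add: mult.commute)
qed

text \<open>A unit column has semimetric 0 to itself, and strict incoherence keeps every other index
  at positive distance, so no tie can occur at a point of \<open>S\<close>.\<close>

lemma nearest_selection_self:
  assumes "\<And>j. norm (column j G) = 1"
    and "\<And>j q. j \<noteq> q \<Longrightarrow> cmod (mu_col (column j G) (column q G)) < 1"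
    and "nearest_selection G S n" and "j \<in> S"
  shows "n j = j"
proof (rule ccontr)
  assume "n j \<noteq> j"
  then have "semimetric G j j < semimetric G j (n j)"
    using assms(1)[of j] assms(2)[of j "n j"] by (simp add: semimetric_def mu_col_self)
  then show False
    using assms(3,4) unfolding nearest_selection_def is_arg_min_def by blast
qed

text \<open>The unit directions of the nonzero rows of \<open>X\<close> form a subgradient of
  \<open>norm12\<close> at \<open>X\<close>: pairing \<open>X\<close> with itself gives
  \<open>norm12 X\<close>. Rows are paired by the unnormalized \<open>mu_col\<close>, which, unlike
  \<open>mu_row\<close>, is linear in its second argument.\<close>

definition row_pairing :: "complex ^ 'v ^ 'y \<Rightarrow> complex ^ 'v ^ 'y \<Rightarrow> complex" where
  "row_pairing X M = (\<Sum>q\<in>row_support X. mu_col (row q X) (row q M) / norm (row q X))"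

lemma row_pairing_diff: "row_pairing X (M - N) = row_pairing X M - row_pairing X N"
  by (simp add: row_pairing_def mu_col_def row_def ring_distribs sum_subtractf diff_divide_distrib)

lemma norm_row_pairing_le:
  "cmod (row_pairing X M) \<le> norm12 (restrict_rows (row_support X) M)"
  unfolding row_pairing_def norm12_restrict_rows
proof (rule order_trans[OF norm_sum], rule sum_mono)
  fix q assume "q \<in> row_support X"
  then have "norm (row q X) > 0" by (simp add: row_support_def)
  then show "cmod (mu_col (row q X) (row q M) / norm (row q X)) \<le> norm (row q M)"
    using norm_mu_col_le[of "row q X" "row q M"]
    by (simp add: norm_divide divide_le_eq mult.commute)
qed

text \<open>Regroups the pairing by the rows of \<open>Z\<close>, so that the contribution of each
  row can be estimated separately.\<close>

lemma row_pairing_gram: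
  "row_pairing X (conj_transpose G ** (G ** Z)) =
     (\<Sum>j\<in>UNIV. \<Sum>q\<in>row_support X. mu_col (column q G) (column j G) *
        (mu_col (row q X) (row j Z) / norm (row q X)))"
  unfolding row_pairing_def row_gram_mult mu_col_sum_scale
  by (subst sum.swap) (simp add: sum_divide_distrib)

text \<open>For each row \<open>j\<close> the term \<open>q = n j\<close> is split off and bounded
  by Cauchy-Schwarz; the interaction coefficient bounds all remaining terms together.\<close>

lemma row_pairing_gram_le:
  assumes "nearest_selection G (row_support X) n"
  shows "cmod (row_pairing X (conj_transpose G ** (G ** Z))) \<le>
    (\<Sum>j\<in>UNIV. (cmod (mu_col (column j G) (column (n j) G)) + interaction_coeff G X n)
       * norm (row j Z))"
  unfolding row_pairing_gram
proof (rule order_trans[OF norm_sum], rule sum_mono)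
  fix j
  let ?S = "row_support X"
  let ?a = "\<lambda>q. cmod (mu_col (column j G) (column q G)) *
        (cmod (mu_col (row q X) (row j Z)) / norm (row q X))"
  have nj: "n j \<in> ?S"
    using assms unfolding nearest_selection_def is_arg_min_def by blast
  then have pos: "norm (row (n j) X) > 0" by (simp add: row_support_def)
  have "cmod (\<Sum>q\<in>?S. mu_col (column q G) (column j G) *
        (mu_col (row q X) (row j Z) / norm (row q X))) \<le> (\<Sum>q\<in>?S. ?a q)"
    by (rule order_trans[OF norm_sum])
       (simp add: norm_mult norm_divide norm_mu_col_commute[of "column _ G" "column j G"])
  also have "\<dots> = ?a (n j) + (\<Sum>q\<in>?S - {n j}. ?a q)"
    using nj by (simp add: sum.remove)
  also have "\<dots> \<le> cmod (mu_col (column j G) (column (n j) G)) * norm (row j Z)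
      + interaction_coeff G X n * norm (row j Z)"
    using pos norm_mu_col_le[of "row (n j) X" "row j Z"]
    by (intro add_mono mult_left_mono interaction_sum_le)
       (simp_all add: divide_le_eq mult.commute)
  finally show "cmod (\<Sum>q\<in>?S. mu_col (column q G) (column j G) *
        (mu_col (row q X) (row j Z) / norm (row q X))) \<le>
      (cmod (mu_col (column j G) (column (n j) G)) + interaction_coeff G X n) * norm (row j Z)"
    by (simp add: ring_distribs)
qed

text \<open>Rows outside the support contribute nothing. For \<open>j\<close> in the support the
  diagonal term is exactly \<open>norm (row j X)\<close>, and \<open>n j = j\<close> makes the
  off-diagonal terms those counted by the interaction coefficient.\<close>

lemma row_pairing_gram_self_ge:
  assumes unit: "\<And>j. norm (column j G) = 1"
    and incoherent: "\<And>j q. j \<noteq> q \<Longrightarrow> cmod (mu_col (column j G) (column q G)) < 1"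
    and nearest: "nearest_selection G (row_support X) n"
  shows "Re (row_pairing X (conj_transpose G ** (G ** X))) \<ge>
    (1 - interaction_coeff G X n) * norm12 X"
proof -
  let ?S = "row_support X" and ?I = "interaction_coeff G X n"
  let ?t = "\<lambda>j q. mu_col (column q G) (column j G) *
        (mu_col (row q X) (row j X) / norm (row q X))"
  have term_ge: "(1 - ?I) * norm (row j X) \<le> Re (\<Sum>q\<in>?S. ?t j q)" for j
  proof (cases "j \<in> ?S")
    case False
    then show ?thesis by (simp add: row_support_def mu_col_def)
  next
    case True
    then have nj: "n j = j"
      using nearest_selection_self[OF unit incoherent nearest] by blast
    have "?t j j = norm (row j X)"
      using True by (simp add: mu_col_self unit row_support_def power2_eq_square)
    then have "Re (\<Sum>q\<in>?S. ?t j q) = norm (row j X) + Re (\<Sum>q\<in>?S - {j}. ?t j q)"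
      using True by (simp add: sum.remove)
    moreover have "cmod (\<Sum>q\<in>?S - {j}. ?t j q) \<le>
        (\<Sum>q\<in>?S - {n j}. cmod (mu_col (column j G) (column q G)) *
          (cmod (mu_col (row q X) (row j X)) / norm (row q X)))"
      unfolding nj by (rule order_trans[OF norm_sum])
        (simp add: norm_mult norm_divide norm_mu_col_commute[of "column _ G" "column j G"])
    moreover have "\<dots> \<le> ?I * norm (row j X)"
      by (rule interaction_sum_le)
    ultimately show ?thesis
      using abs_Re_le_cmod[of "\<Sum>q\<in>?S - {j}. ?t j q"] by (simp add: left_diff_distrib)
  qed
  have "(1 - ?I) * norm12 X = (\<Sum>j\<in>UNIV. (1 - ?I) * norm (row j X))"
    by (simp add: norm12_def sum_distrib_left)
  also have "\<dots> \<le> (\<Sum>j\<in>UNIV. Re (\<Sum>q\<in>?S. ?t j q))"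
    by (intro sum_mono term_ge)
  finally show ?thesis by (simp add: row_pairing_gram)
qed

text \<open>On the neighbourhood the row of \<open>E\<close> vanishes and the correlation with the
  nearest column is at most 1. Off it the row of \<open>Y\<close> is that of \<open>E\<close>, and
  the correlation is at most \<open>1 - r\<close>; this saves \<open>r * norm12 E\<close>.\<close>

lemma row_pairing_gram_le_off_nbhd:
  assumes unit: "\<And>j. norm (column j G) = 1"
    and nearest: "nearest_selection G (row_support X) n"
    and Y: "Y = P + E"
    and P: "row_supported_in (semimetric_nbhd G r (row_support X)) P"
    and E: "row_supported_in (- semimetric_nbhd G r (row_support X)) E"
  shows "cmod (row_pairing X (conj_transpose G ** (G ** Y))) \<le>
    (1 + interaction_coeff G X n) * norm12 Y - r * norm12 E"
proof -
  let ?I = "interaction_coeff G X n" and ?B = "semimetric_nbhd G r (row_support X)"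
  let ?m = "\<lambda>j. cmod (mu_col (column j G) (column (n j) G))"
  have "(?m j + ?I) * norm (row j Y) \<le> (1 + ?I) * norm (row j Y) - r * norm (row j E)" for j
  proof (cases "j \<in> ?B")
    case True
    have "row j E = 0" using E True by (simp add: row_supported_in_def)
    moreover have "?m j \<le> 1"
      using norm_mu_col_le[of "column j G" "column (n j) G"] by (simp add: unit)
    ultimately show ?thesis by (simp add: mult_right_mono)
  next
    case False
    have "row j P = 0" using P False by (simp add: row_supported_in_def)
    then have "row j Y = row j E" by (simp add: Y row_def vec_eq_iff)
    moreover have "n j \<in> row_support X"
      using nearest unfolding nearest_selection_def is_arg_min_def by blast
    then have "?m j \<le> 1 - r"
      using False unfolding semimetric_nbhd_def semimetric_def by force
    then have "(?m j + ?I) * norm (row j E) \<le> (1 - r + ?I) * norm (row j E)"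
      by (intro mult_right_mono) auto
    ultimately show ?thesis by (simp add: algebra_simps)
  qed
  then have "(\<Sum>j\<in>UNIV. (?m j + ?I) * norm (row j Y)) \<le>
      (\<Sum>j\<in>UNIV. (1 + ?I) * norm (row j Y) - r * norm (row j E))"
    by (intro sum_mono)
  with row_pairing_gram_le[OF nearest, of Y] show ?thesis
    by (simp add: norm12_def sum_subtractf sum_distrib_left)
qed

theorem theorem2p1:
  fixes G :: "complex ^ 'y ^ 'r"
    and X X\<epsilon> :: "complex ^ 'v ^ 'y"
    and W D\<^sub>W W\<epsilon> :: "complex ^ 'v ^ 'r"
    and S :: "'y set"
    and \<epsilon> :: real
  assumes "\<And>j. norm (column j G) = 1"
    and "\<And>j q. j \<noteq> q \<Longrightarrow> cmod (mu_col (column j G) (column q G)) < 1"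
    and "X \<noteq> 0"
    and "S = row_support X"
    and "D\<^sub>W = G ** X + W"
    and "\<epsilon> > 0"
    and "norm W < \<epsilon>"
    and "is_arg_min norm12 (\<lambda>Z. norm (G ** Z - D\<^sub>W) \<le> \<epsilon>) X\<epsilon>"
    and "W\<epsilon> = G ** (X\<epsilon> - X)"
  shows "norm W\<epsilon> \<le> 2 * \<epsilon> \<and>
    (\<forall>(n :: 'y \<Rightarrow> 'y) (r :: real) (X\<epsilon>r :: complex ^ 'v ^ 'y) (E\<epsilon>r :: complex ^ 'v ^ 'y).
       nearest_selection G S n \<longrightarrow>
       0 < r \<longrightarrow> 2 * interaction_coeff G X n < r \<longrightarrow> r < 1 \<longrightarrow>
       X\<epsilon> = X\<epsilon>r + E\<epsilon>r \<longrightarrow>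
       row_supported_in (semimetric_nbhd G r S) X\<epsilon>r \<longrightarrow>
       row_supported_in (- semimetric_nbhd G r S) E\<epsilon>r \<longrightarrow>
         norm12 E\<epsilon>r \<le> 2 * interaction_coeff G X n / r * norm12 X\<epsilon>
           + 1 / r * norm12 (restrict_rows S (conj_transpose G ** W\<epsilon>)) \<and>
         2 * interaction_coeff G X n / r * norm12 X\<epsilon>
           + 1 / r * norm12 (restrict_rows S (conj_transpose G ** W\<epsilon>))
         \<le> 2 * interaction_coeff G X n / r * norm12 X\<epsilon> + 2 * \<epsilon> * real (card S) / r)"
proof (intro conjI allI impI)
  note unit = assms(1) and incoherent = assms(2)
  have feasible: "norm (G ** X\<epsilon> - D\<^sub>W) \<le> \<epsilon>"
    and minimal: "norm (G ** Z - D\<^sub>W) \<le> \<epsilon> \<Longrightarrow> norm12 X\<epsilon> \<le> norm12 Z" for Z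
    using assms(8) by (auto simp: is_arg_min_linorder)
  \<comment> \<open>The constraint residual and the noise each have norm at most the
    tolerance.\<close>
  have residual: "W\<epsilon> = (G ** X\<epsilon> - D\<^sub>W) + W"
    by (simp add: assms(5,9) matrix_mult_diff_right)
  show W\<epsilon>_le: "norm W\<epsilon> \<le> 2 * \<epsilon>"
    unfolding residual using norm_triangle_ineq[of "G ** X\<epsilon> - D\<^sub>W" W] feasible assms(7) by linarith
  fix n r X\<epsilon>r E\<epsilon>r
  assume nearest: "nearest_selection G S n" and r: "0 < r" "2 * interaction_coeff G X n < r" "r < 1"
    and split: "X\<epsilon> = X\<epsilon>r + E\<epsilon>r"
    and "row_supported_in (semimetric_nbhd G r S) X\<epsilon>r"
    and "row_supported_in (- semimetric_nbhd G r S) E\<epsilon>r"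
  let ?I = "interaction_coeff G X n" and ?A = "conj_transpose G"
  let ?N = "norm12 (restrict_rows S (?A ** W\<epsilon>))"
  \<comment> \<open>\<open>X\<close> is feasible, since its residual is \<open>- W\<close>.\<close>
  have "norm12 X\<epsilon> \<le> norm12 X"
    by (rule minimal) (use assms(5,7) in simp)
  \<comment> \<open>From \<open>2 * ?I < r < 1\<close> the factor \<open>1 - ?I\<close> is
    positive.\<close>
  then have "(1 - ?I) * norm12 X\<epsilon> \<le> (1 - ?I) * norm12 X"
    by (rule mult_left_mono) (use r in linarith)
  also have "\<dots> \<le> Re (row_pairing X (?A ** (G ** X)))"
    using row_pairing_gram_self_ge[OF unit incoherent] nearest assms(4) by blast
  also have "\<dots> = Re (row_pairing X (?A ** (G ** X\<epsilon>))) - Re (row_pairing X (?A ** W\<epsilon>))"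
    by (simp add: assms(9) matrix_mult_diff_right row_pairing_diff)
  also have "\<dots> \<le> (1 + ?I) * norm12 X\<epsilon> - r * norm12 E\<epsilon>r + ?N"
  proof -
    have "cmod (row_pairing X (?A ** (G ** X\<epsilon>))) \<le> (1 + ?I) * norm12 X\<epsilon> - r * norm12 E\<epsilon>r"
      using row_pairing_gram_le_off_nbhd[OF unit] nearest split assms(4)
        \<open>row_supported_in _ X\<epsilon>r\<close> \<open>row_supported_in _ E\<epsilon>r\<close> by blast
    moreover have "cmod (row_pairing X (?A ** W\<epsilon>)) \<le> ?N"
      unfolding assms(4) by (rule norm_row_pairing_le)
    ultimately show ?thesis
      using abs_Re_le_cmod[of "row_pairing X (?A ** (G ** X\<epsilon>))"]
        abs_Re_le_cmod[of "row_pairing X (?A ** W\<epsilon>)"] by linarith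
  qed
  \<comment> \<open>Moving \<open>(1 - ?I)\<close> times the norm of the minimizer to the right
    leaves \<open>2 * ?I\<close> times that norm.\<close>
  finally have "r * norm12 E\<epsilon>r \<le> 2 * ?I * norm12 X\<epsilon> + ?N"
    by (simp add: algebra_simps)
  then show "norm12 E\<epsilon>r \<le> 2 * ?I / r * norm12 X\<epsilon> + 1 / r * ?N"
    using r by (simp add: field_simps)
  \<comment> \<open>Columns of \<open>G\<close> are unit vectors, so each of the
    \<open>card S\<close> rows is bounded by the full Frobenius norm.\<close>
  have "?N \<le> (\<Sum>q\<in>S. norm W\<epsilon>)"
    unfolding norm12_restrict_rows
    using norm_row_conj_transpose_mult_le[of _ G W\<epsilon>] by (intro sum_mono) (simp add: unit)
  also have "\<dots> \<le> 2 * \<epsilon> * real (card S)"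
    using mult_right_mono[OF W\<epsilon>_le, of "real (card S)"] by (simp add: mult.commute)
  finally show "2 * ?I / r * norm12 X\<epsilon> + 1 / r * ?N \<le>
      2 * ?I / r * norm12 X\<epsilon> + 2 * \<epsilon> * real (card S) / r"
    using r by (simp add: divide_right_mono)
qed

end
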